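(* Let $n\ge 5$. There is a finite collection $Q_1,\dots,Q_m$ of homogeneous polynomials, none identically zero, in the entries of the parameter collection $\mathbf c=\{c_i^{kj}\}$ such that the following holds. For every real parameter collection $\mathbf c$ with $Q_s(\mathbf c)\neq 0$ for all $s=1,\dots,m$, and for all sufficiently small $t>0$ (depending on $\mathbf c$), the characteristic variety $\Sigma(t\mathbf c)$ is not smooth in $\mathbb R^n\setminus\{0\}$.
   Context: A parameter collection is a family of real numbers $\mathbf c=\{c_i^{kj}\}$, with $i,j,k\in\{1,\dots,n\}$, $k\ne j$, satisfying $c_i^{kj}=c_i^{jk}$ (so there are $n^2(n-1)/2$ free entries; the index $i$ may coincide with $j$ or $k$). For real $t$ write $t\mathbf c=\{tc_i^{kj}\}_{k\neq j}$. For $\xi=(\xi_1,\dots,\xi_n)\in\mathbb R^n$ the principal symbol is the $n\times n$ matrix $P(\xi,\mathbf c)=(p_{ij})$ with $$p_{ii}=\xi_i+\sum_{k\ne i}c_i^{ki}\xi_k,\qquad p_{ij}=\sum_{k\ne j}c_i^{kj}\xi_k\quad (i\ne j).$$ The characteristic variety is $\Sigma(\mathbf c)=\{\xi\in\mathbb R^n\setminus\{0\}: \det P(\xi,\mathbf c)=0\}$. Its singular part is $\Sigma_{\rm sing}(\mathbf c)=\{\xi\in\mathbb R^n\setminus\{0\}: \operatorname{rank}P(\xi,\mathbf c)\le n-2\}$, and $\Sigma(\mathbf c)$ is called smooth if $\Sigma_{\rm sing}(\mathbf c)=\emptyset$ and not smooth otherwise. *)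

theory Defs
  imports "HOL-Analysis.Analysis" "HOL-Library.Poly_Mapping"
begin

text \<open>The entry \<open>c\<^sub>i\<^bsup>kj\<^esup>\<close> is written \<open>c i k j\<close>; the index set \<open>{1,\<dots>,n}\<close> is the finite
  type \<open>'n\<close>.  Only entries with \<open>k \<noteq> j\<close> belong to a parameter collection: the values
  \<open>c i k k\<close> are unconstrained and nothing below depends on them.\<close>

type_synonym 'n params = "'n \<Rightarrow> 'n \<Rightarrow> 'n \<Rightarrow> real"

definition parameter_collection :: "'n params \<Rightarrow> bool" where
  "parameter_collection c \<longleftrightarrow> (\<forall>i k j. k \<noteq> j \<longrightarrow> c i k j = c i j k)"

definition scale_params :: "real \<Rightarrow> 'n params \<Rightarrow> 'n params" where
  "scale_params t c = (\<lambda>i k j. t * c i k j)"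

definition principal_symbol :: "real ^ 'n \<Rightarrow> 'n::finite params \<Rightarrow> real ^ 'n ^ 'n" where
  "principal_symbol \<xi> c =
     (\<chi> i j. if i = j then \<xi> $ i + (\<Sum>k\<in>UNIV - {i}. c i k i * \<xi> $ k)
             else (\<Sum>k\<in>UNIV - {j}. c i k j * \<xi> $ k))"

definition char_variety :: "'n::finite params \<Rightarrow> (real ^ 'n) set" where
  "char_variety c = {\<xi>. \<xi> \<noteq> 0 \<and> det (principal_symbol \<xi> c) = 0}"

text \<open>The bound \<open>rank \<le> n - 2\<close> is stated without truncated subtraction.\<close>

definition char_variety_sing :: "'n::finite params \<Rightarrow> (real ^ 'n) set" where
  "char_variety_sing c = {\<xi>. \<xi> \<noteq> 0 \<and> rank (principal_symbol \<xi> c) + 2 \<le> CARD('n)}"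

definition smooth_char_variety :: "'n::finite params \<Rightarrow> bool" where
  "smooth_char_variety c \<longleftrightarrow> char_variety_sing c = {}"

lemma char_variety_sing_subset: "char_variety_sing c \<subseteq> char_variety c"
proof
  fix \<xi> assume "\<xi> \<in> char_variety_sing c"
  then have "\<xi> \<noteq> 0" and r: "rank (principal_symbol \<xi> c) < CARD('a)"
    by (auto simp: char_variety_sing_def)
  moreover have "det (principal_symbol \<xi> c) = 0"
    using r by (simp add: less_rank_noninjective flip: det_nz_iff_inj)
  ultimately show "\<xi> \<in> char_variety c"
    by (simp add: char_variety_def)
qed

text \<open>Real polynomials in variables indexed by \<open>'v\<close>: finitely supported maps from monomials
  (finitely supported exponent maps) to coefficients.\<close>

type_synonym 'v real_mpoly = "('v \<Rightarrow>\<^sub>0 nat) \<Rightarrow>\<^sub>0 real"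

definition mpoly_vars :: "'v real_mpoly \<Rightarrow> 'v set" where
  "mpoly_vars Q = (\<Union>m\<in>Poly_Mapping.keys Q. Poly_Mapping.keys m)"

definition mpoly_eval :: "'v real_mpoly \<Rightarrow> ('v \<Rightarrow> real) \<Rightarrow> real" where
  "mpoly_eval Q x =
     (\<Sum>m\<in>Poly_Mapping.keys Q. Poly_Mapping.lookup Q m *
        (\<Prod>v\<in>Poly_Mapping.keys m. x v ^ Poly_Mapping.lookup m v))"

definition homogeneous_mpoly :: "'v real_mpoly \<Rightarrow> bool" where
  "homogeneous_mpoly Q \<longleftrightarrow>
     (\<exists>d. \<forall>m\<in>Poly_Mapping.keys Q. (\<Sum>v\<in>Poly_Mapping.keys m. Poly_Mapping.lookup m v) = d)"

text \<open>A polynomial in the entries of a parameter collection has a variable \<open>(i,k,j)\<close> for each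
  entry with \<open>k \<noteq> j\<close>.\<close>

definition param_poly :: "('n \<times> 'n \<times> 'n) real_mpoly \<Rightarrow> bool" where
  "param_poly Q \<longleftrightarrow> mpoly_vars Q \<subseteq> {(i, k, j). k \<noteq> j}"

definition param_poly_eval :: "('n \<times> 'n \<times> 'n) real_mpoly \<Rightarrow> 'n params \<Rightarrow> real" where
  "param_poly_eval Q c = mpoly_eval Q (\<lambda>(i, k, j). c i k j)"

text \<open>Because of the symmetry \<open>c i k j = c i j k\<close> the entries are not independent (the nonzero
  formal polynomial \<open>c i k j - c i j k\<close> vanishes on every parameter collection), so being
  identically zero means vanishing on all parameter collections.  This is the same as being zero
  as a polynomial in the \<open>n\<^sup>2(n-1)/2\<close> free entries.\<close>

definition identically_zero :: "('n \<times> 'n \<times> 'n) real_mpoly \<Rightarrow> bool" where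
  "identically_zero Q \<longleftrightarrow> (\<forall>c. parameter_collection c \<longrightarrow> param_poly_eval Q c = 0)"

end

theory Submission
  imports Defs
begin

text \<open>
  The matrix \<open>P(\<xi>, t c)\<close> is \<open>diag \<xi> + t C(\<xi>)\<close> with \<open>C\<close> linear in \<open>\<xi>\<close>.  At \<open>t = 0\<close> its kernel is
  two-dimensional wherever exactly two coordinates \<open>\<xi>\<^sub>a\<close>, \<open>\<xi>\<^sub>b\<close> vanish.  Rank at most \<open>n - 2\<close> amounts
  to four equations on \<open>\<xi>\<close>, homogeneous, so for \<open>n \<ge> 5\<close> one expects some such point to
  survive the perturbation, and the task is to find which one does.

  A kernel basis close to the axis vectors at \<open>a\<close> and \<open>b\<close> can be normalised to
  \<open>v\<close> with \<open>(v\<^sub>a, v\<^sub>b) = (1, 0)\<close> and \<open>w\<close> with \<open>(w\<^sub>a, w\<^sub>b) = (0, 1)\<close>.  In \<open>P v = 0\<close> and \<open>P w = 0\<close>, the rows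
  other than \<open>a\<close>, \<open>b\<close> determine the remaining entries of \<open>v\<close> and \<open>w\<close>, all of order \<open>t\<close>; row \<open>a\<close>
  for \<open>v\<close> and row \<open>b\<close> for \<open>w\<close> determine \<open>\<xi>\<^sub>a\<close> and \<open>\<xi>\<^sub>b\<close>, again of order \<open>t\<close>.  Two equations remain,
  row \<open>a\<close> for \<open>w\<close> and row \<open>b\<close> for \<open>v\<close>.  After division by \<open>t\<close> their limits as \<open>t\<close> tends to \<open>0\<close> are
  \[ \sum_k c_a^{kb} \xi_k = 0, \qquad \sum_k c_b^{ka} \xi_k = 0 \qquad (k \ne a, b). \]
  There are at least three unknowns \<open>\<xi>\<^sub>k\<close>, so this linear system has a nonzero solution \<open>\<zeta>\<close>.
  It can be solved by Cramer's rule for two of the unknowns, \<open>\<zeta>\<^sub>p\<close> and \<open>\<zeta>\<^sub>q\<close>, with all others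
  equal to the determinant in the denominator.  The determinant, \<open>\<zeta>\<^sub>p\<close> and \<open>\<zeta>\<^sub>q\<close> are then quadratic
  forms in the entries of \<open>c\<close>, and they are the polynomials \<open>Q\<^sub>s\<close>: where they do not vanish,
  \<open>\<zeta>\<close> vanishes only at \<open>a\<close> and \<open>b\<close>, and the limit system is nondegenerate in \<open>(\<xi>\<^sub>p, \<xi>\<^sub>q)\<close>.

  Nondegeneracy lets \<open>\<zeta>\<close> be continued to small \<open>t > 0\<close>
  (\<open>not_smooth_near_double_axis\<close>).  The full system is written as a fixed point equation
  \<open>\<Phi>(t, x) = x\<close> for \<open>x = (\<xi>, v, w)\<close> in such a way that \<open>\<Phi>(0, \<cdot>)\<close> is constant; by compactness
  \<open>\<Phi>(t, \<cdot>)\<close> maps a ball to itself for small \<open>t\<close>, and Brouwer's theorem applies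
  (\<open>fixed_point_near_constant_map\<close>).
\<close>

section \<open>Quadratic forms in the parameters\<close>

lemma mpoly_eval_superset:
  assumes "finite A" "Poly_Mapping.keys Q \<subseteq> A"
  shows "mpoly_eval Q x =
    (\<Sum>m\<in>A. Poly_Mapping.lookup Q m * (\<Prod>v\<in>Poly_Mapping.keys m. x v ^ Poly_Mapping.lookup m v))"
  unfolding mpoly_eval_def
  by (rule sum.mono_neutral_left) (use assms in \<open>auto simp: in_keys_iff\<close>)

lemma mpoly_eval_add: "mpoly_eval (Q + R) x = mpoly_eval Q x + mpoly_eval R x"
proof -
  let ?A = "Poly_Mapping.keys Q \<union> Poly_Mapping.keys R"
  have "mpoly_eval (Q + R) x = (\<Sum>m\<in>?A. Poly_Mapping.lookup (Q + R) m *
      (\<Prod>v\<in>Poly_Mapping.keys m. x v ^ Poly_Mapping.lookup m v))"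
    by (rule mpoly_eval_superset) (auto intro!: Poly_Mapping.keys_add)
  also have "\<dots> = mpoly_eval Q x + mpoly_eval R x"
    by (simp add: mpoly_eval_superset[of ?A] lookup_add distrib_right sum.distrib)
  finally show ?thesis .
qed

lemma mpoly_eval_sum: "mpoly_eval (\<Sum>i\<in>I. Q i) x = (\<Sum>i\<in>I. mpoly_eval (Q i) x)"
proof (induction I rule: infinite_finite_induct)
  case (insert i I)
  then show ?case by (simp add: mpoly_eval_add)
qed (simp_all add: mpoly_eval_def)

text \<open>Requiring \<open>u i \<noteq> v i\<close> keeps every monomial squarefree, so that both of its exponents are \<open>1\<close>.\<close>

lemma quadratic_mpoly:
  fixes u v :: "'i \<Rightarrow> 'v" and \<kappa> :: "'i \<Rightarrow> real"
  assumes "\<And>i. i \<in> I \<Longrightarrow> u i \<noteq> v i"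
  shows "\<exists>Q. homogeneous_mpoly Q \<and> mpoly_vars Q \<subseteq> u ` I \<union> v ` I \<and>
    (\<forall>x. mpoly_eval Q x = (\<Sum>i\<in>I. \<kappa> i * x (u i) * x (v i)))"
proof -
  define mon where "mon i = Poly_Mapping.single (u i) (1::nat) + Poly_Mapping.single (v i) 1" for i
  define Q where "Q = (\<Sum>i\<in>I. Poly_Mapping.single (mon i) (\<kappa> i))"
  have keys_mon: "Poly_Mapping.keys (mon i) = {u i, v i}" for i
    by (auto simp: mon_def in_keys_iff lookup_add lookup_single when_def split: if_splits)
  have lookup_mon: "Poly_Mapping.lookup (mon i) (u i) = 1" "Poly_Mapping.lookup (mon i) (v i) = 1"
    if "i \<in> I" for i
    using assms[OF that] by (auto simp: mon_def lookup_add lookup_single when_def)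
  have keys_Q: "Poly_Mapping.keys Q \<subseteq> mon ` I"
  proof -
    have "Poly_Mapping.keys Q \<subseteq> (\<Union>i\<in>I. Poly_Mapping.keys (Poly_Mapping.single (mon i) (\<kappa> i)))"
      unfolding Q_def by (rule Poly_Mapping.keys_sum)
    also have "\<dots> \<subseteq> mon ` I" by (auto split: if_splits)
    finally show ?thesis .
  qed
  have "homogeneous_mpoly Q"
    unfolding homogeneous_mpoly_def
    by (rule exI[of _ 2]) (use keys_Q keys_mon lookup_mon assms in \<open>force simp: card_insert_if\<close>)
  moreover have "mpoly_vars Q \<subseteq> u ` I \<union> v ` I"
    using keys_Q keys_mon by (fastforce simp: mpoly_vars_def)
  moreover have "mpoly_eval Q x = (\<Sum>i\<in>I. \<kappa> i * x (u i) * x (v i))" for x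
  proof -
    have "mpoly_eval (Poly_Mapping.single (mon i) (\<kappa> i)) x = \<kappa> i * x (u i) * x (v i)"
      if "i \<in> I" for i
      using keys_mon lookup_mon[OF that] assms[OF that] by (simp add: mpoly_eval_def)
    then show ?thesis by (simp add: Q_def mpoly_eval_sum)
  qed
  ultimately show ?thesis by blast
qed

text \<open>The forms \<open>\<xi> \<mapsto> \<Sum>\<^sub>k c\<^sub>a\<^bsup>kb\<^esup> \<xi>\<^sub>k\<close> and \<open>\<xi> \<mapsto> \<Sum>\<^sub>k c\<^sub>b\<^bsup>ka\<^esup> \<xi>\<^sub>k\<close> make up a matrix with two rows.  This is
  the determinant of the sum of its columns in \<open>K\<close> and the sum of its columns in \<open>L\<close>; all the
  determinants in Cramer's rule have this shape.\<close>

definition block_minor :: "'n params \<Rightarrow> 'n \<Rightarrow> 'n \<Rightarrow> 'n set \<Rightarrow> 'n set \<Rightarrow> real" where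
  "block_minor c a b K L =
     (\<Sum>k\<in>K. c a k b) * (\<Sum>l\<in>L. c b l a) - (\<Sum>l\<in>L. c a l b) * (\<Sum>k\<in>K. c b k a)"

text \<open>The entries \<open>c\<^sub>a\<^bsup>kb\<^esup>\<close> and \<open>c\<^sub>b\<^bsup>ka\<^esup>\<close> with \<open>k \<noteq> a, b\<close> are unrelated by the symmetry of \<open>c\<close>, so
  they can be prescribed freely: indicators of \<open>K\<close> in the first row and of \<open>L\<close> in the second make
  the determinant equal to \<open>card K * card L\<close>.\<close>

lemma block_minor_param_poly:
  fixes a b :: "'n::finite"
  assumes "a \<noteq> b" "K \<inter> L = {}" "K \<noteq> {}" "L \<noteq> {}" "a \<notin> K \<union> L" "b \<notin> K \<union> L"
  shows "\<exists>Q. param_poly Q \<and> homogeneous_mpoly Q \<and> \<not> identically_zero Q \<and>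
    (\<forall>c. param_poly_eval Q c = block_minor c a b K L)"
proof -
  let ?I = "K \<times> L \<union> L \<times> K" and ?u = "\<lambda>(k, l). (a, k, b)" and ?v = "\<lambda>(k, l). (b, l, a)"
  let ?\<kappa> = "\<lambda>(k, l). if k \<in> K then 1 else - 1 :: real"
  obtain Q where Q: "homogeneous_mpoly Q" "mpoly_vars Q \<subseteq> ?u ` ?I \<union> ?v ` ?I"
    "\<And>x. mpoly_eval Q x = (\<Sum>i\<in>?I. ?\<kappa> i * x (?u i) * x (?v i))"
    using quadratic_mpoly[of ?I ?u ?v ?\<kappa>] assms(1) by auto
  have eval: "param_poly_eval Q c = block_minor c a b K L" for c
  proof -
    let ?f = "\<lambda>(k, l). ?\<kappa> (k, l) * c a k b * c b l a"
    have "param_poly_eval Q c = sum ?f ?I"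
      by (auto simp: param_poly_eval_def Q(3) intro!: sum.cong)
    also have "\<dots> = sum ?f (K \<times> L) + sum ?f (L \<times> K)"
      using assms(2) by (intro sum.union_disjoint) auto
    also have "sum ?f (K \<times> L) = (\<Sum>k\<in>K. c a k b) * (\<Sum>l\<in>L. c b l a)"
      by (auto simp: sum_product sum.cartesian_product intro!: sum.cong)
    also have "sum ?f (L \<times> K) = (\<Sum>i\<in>L \<times> K. - (c a (fst i) b * c b (snd i) a))"
      using assms(2) by (auto intro!: sum.cong)
    also have "\<dots> = - ((\<Sum>l\<in>L. c a l b) * (\<Sum>k\<in>K. c b k a))"
      by (simp add: sum_negf sum_product sum.cartesian_product split_def)
    finally show ?thesis by (simp add: block_minor_def)
  qed
  \<comment> \<open>The two indicator rows, symmetrised in the last two indices.\<close>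
  define e where "e i x y \<longleftrightarrow> i = a \<and> x \<in> K \<and> y = b \<or> i = b \<and> x \<in> L \<and> y = a" for i x y
  define c where "c i x y = (if e i x y \<or> e i y x then 1 else 0 :: real)" for i x y
  have "parameter_collection c"
    by (auto simp: parameter_collection_def c_def)
  moreover have "block_minor c a b K L \<noteq> 0"
  proof -
    have "(\<Sum>k\<in>K. c a k b) = card K" "(\<Sum>l\<in>L. c b l a) = card L" "(\<Sum>l\<in>L. c a l b) = 0"
      using assms by (auto simp: c_def e_def if_distrib sum.If_cases intro!: sum.neutral split: if_splits)
    then show ?thesis using assms by (simp add: block_minor_def)
  qed
  ultimately have "\<not> identically_zero Q"
    using eval by (auto simp: identically_zero_def)
  moreover have "param_poly Q"
    using Q(2) assms by (force simp: param_poly_def)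
  ultimately show ?thesis using Q(1) eval by blast
qed

section \<open>Fixed points near a constant map\<close>

text \<open>Uniform continuity on the compact set \<open>{0..1} \<times> cball x0 r\<close> keeps \<open>\<Phi> (t, x)\<close> within \<open>r\<close> of
  \<open>\<Phi> (0, x) = x0\<close> for all small \<open>t\<close>, uniformly in \<open>x\<close>, so the ball is mapped to itself.\<close>

lemma fixed_point_near_constant_map:
  fixes \<Phi> :: "real \<times> 'a::euclidean_space \<Rightarrow> 'a"
  assumes "r > 0" and cont: "continuous_on ({0..1} \<times> cball x0 r) \<Phi>"
    and const: "\<And>x. x \<in> cball x0 r \<Longrightarrow> \<Phi> (0, x) = x0"
  shows "\<exists>t0>0. \<forall>t. 0 < t \<longrightarrow> t < t0 \<longrightarrow> (\<exists>x\<in>cball x0 r. \<Phi> (t, x) = x)"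
proof -
  have "uniformly_continuous_on ({0..1} \<times> cball x0 r) \<Phi>"
    by (intro compact_uniformly_continuous cont compact_Times) auto
  then obtain d where "d > 0" and d: "\<And>s s'. s \<in> {0..1} \<times> cball x0 r \<Longrightarrow>
      s' \<in> {0..1} \<times> cball x0 r \<Longrightarrow> dist s' s < d \<Longrightarrow> dist (\<Phi> s') (\<Phi> s) < r"
    unfolding uniformly_continuous_on_def using \<open>r > 0\<close> by metis
  have "\<exists>x\<in>cball x0 r. \<Phi> (t, x) = x" if t: "0 < t" "t < min 1 d" for t
  proof -
    have "continuous_on (cball x0 r) (\<lambda>x. \<Phi> (t, x))"
      using t by (intro continuous_on_compose2[OF cont] continuous_intros) auto
    moreover have "\<Phi> (t, x) \<in> cball x0 r" if "x \<in> cball x0 r" for x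
      using d[of "(0, x)" "(t, x)"] const[OF that] that t
      by (simp add: dist_Pair_Pair dist_commute)
    ultimately show ?thesis
      using brouwer_ball[OF \<open>r > 0\<close>, of x0 "\<lambda>x. \<Phi> (t, x)"] by blast
  qed
  then show ?thesis using \<open>d > 0\<close> by (intro exI[of _ "min 1 d"]) auto
qed

section \<open>Kernel vectors of the principal symbol\<close>

text \<open>The \<open>i\<close>-th entry of \<open>C(\<xi>) v\<close>, where \<open>P(\<xi>, c) = diag \<xi> + C(\<xi>)\<close>.\<close>

definition coupling :: "'n::finite params \<Rightarrow> real ^ 'n \<Rightarrow> real ^ 'n \<Rightarrow> 'n \<Rightarrow> real" where
  "coupling c \<xi> v i = (\<Sum>j\<in>UNIV. (\<Sum>k\<in>UNIV - {j}. c i k j * \<xi> $ k) * v $ j)"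

lemma principal_symbol_scale_mult:
  "(principal_symbol \<xi> (scale_params t c) *v v) $ i = \<xi> $ i * v $ i + t * coupling c \<xi> v i"
proof -
  have "(principal_symbol \<xi> (scale_params t c) *v v) $ i =
      (\<Sum>j\<in>UNIV. (if j = i then \<xi> $ i * v $ i else 0)
         + t * ((\<Sum>k\<in>UNIV - {j}. c i k j * \<xi> $ k) * v $ j))"
    by (auto simp: matrix_vector_mult_def principal_symbol_def scale_params_def
        sum_distrib_left algebra_simps intro!: sum.cong)
  then show ?thesis by (simp add: sum.distrib coupling_def sum_distrib_left)
qed

lemma coupling_axis: "coupling c \<xi> (axis j 1) i = (\<Sum>k\<in>UNIV - {j}. c i k j * \<xi> $ k)"
  by (simp add: coupling_def axis_def if_distrib cong: if_cong)

lemma continuous_on_coupling [continuous_intros]: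
  assumes "continuous_on S f" "continuous_on S g"
  shows "continuous_on S (\<lambda>x. coupling c (f x) (g x) i)"
  unfolding coupling_def by (intro continuous_intros assms)

text \<open>Kernel vectors are orthogonal to the rows, so \<open>v\<close>, \<open>w\<close> and the row space together span a space of
  dimension \<open>2 + rank A\<close>.\<close>

lemma rank_add_2_le:
  fixes A :: "real ^ 'n ^ 'n"
  assumes "A *v v = 0" "A *v w = 0"
    and "a \<noteq> b" "v $ a = 1" "v $ b = 0" "w $ a = 0" "w $ b = 1"
  shows "rank A + 2 \<le> CARD('n)"
proof -
  have "v \<notin> span {w}" "w \<noteq> 0" "v \<noteq> w" using assms by (auto simp: span_singleton)
  then have "independent {v, w}"
    by (simp add: independent_insert)
  then have "dim {v, w} = 2" using \<open>v \<noteq> w\<close> by (simp add: dim_eq_card_independent)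
  moreover have "dim {v, w} + dim (rows A) = dim ({v, w} \<union> rows A)"
    using assms(1,2) by (intro dim_orthogonal_sum[symmetric])
      (auto simp: rows_def row_def matrix_vector_mult_def inner_vec_def vec_eq_iff mult.commute)
  moreover have "dim ({v, w} \<union> rows A) \<le> CARD('n)"
    using dim_subset_UNIV[of "{v, w} \<union> rows A"] by simp
  ultimately show ?thesis by (simp add: row_rank_def)
qed

section \<open>Continuation of a point of rank deficiency two\<close>

text \<open>This is an implicit function argument.  The singular points for small \<open>t\<close> branch off from
  \<open>\<zeta>\<close>; the minor at \<open>p\<close>, \<open>q\<close> is the Jacobian determinant of the limit system in \<open>(\<xi>\<^sub>p, \<xi>\<^sub>q)\<close>, and the
  nonvanishing of \<open>\<zeta>\<^sub>i\<close> for \<open>i \<noteq> a, b\<close> allows row \<open>i\<close> to be solved for \<open>v\<^sub>i\<close> and \<open>w\<^sub>i\<close>.  The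
  coordinates of \<open>\<xi>\<close> other than \<open>a, b, p, q\<close> are held at their values in \<open>\<zeta>\<close>.\<close>

lemma not_smooth_near_double_axis:
  fixes c :: "'n::finite params" and \<zeta> :: "real ^ 'n"
  assumes distinct: "distinct [a, b, p, q]"
    and minor: "block_minor c a b {p} {q} \<noteq> 0"
    and \<zeta>_ab: "\<zeta> $ a = 0" "\<zeta> $ b = 0"
    and \<zeta>_nz: "\<And>i. i \<noteq> a \<Longrightarrow> i \<noteq> b \<Longrightarrow> \<zeta> $ i \<noteq> 0"
    and eq_ab: "(\<Sum>k\<in>UNIV - {a, b}. c a k b * \<zeta> $ k) = 0"
    and eq_ba: "(\<Sum>k\<in>UNIV - {a, b}. c b k a * \<zeta> $ k) = 0"
  shows "\<exists>t0>0. \<forall>t. 0 < t \<longrightarrow> t < t0 \<longrightarrow> \<not> smooth_char_variety (scale_params t c)"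
proof -
  define D where "D = c a p b * c b q a - c a q b * c b p a"
  have "D \<noteq> 0" using minor by (simp add: D_def block_minor_def)
  \<comment> \<open>First half of the iteration: each equation that determines an entry of \<open>v\<close>, of \<open>w\<close>, or \<open>\<xi>\<^sub>a\<close>
    or \<open>\<xi>\<^sub>b\<close> is solved for it.  At \<open>t = 0\<close> these updates do not depend on the old values.\<close>
  define vnew where "vnew = (\<lambda>(t, \<xi>, v, w :: real ^ 'n). \<chi> i. if i = a then 1 else if i = b then 0
     else - t * coupling c \<xi> v i / \<xi> $ i)"
  define wnew where "wnew = (\<lambda>(t, \<xi>, v :: real ^ 'n, w). \<chi> i. if i = a then 0 else if i = b then 1
     else - t * coupling c \<xi> w i / \<xi> $ i)"
  define \<eta> where "\<eta> = (\<lambda>(t, \<xi>, v, w). \<chi> i. if i = a then - t * coupling c \<xi> v a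
     else if i = b then - t * coupling c \<xi> w b else if i = p \<or> i = q then \<xi> $ i else \<zeta> $ i)"
  \<comment> \<open>Second half: a Newton step in \<open>(\<xi>\<^sub>p, \<xi>\<^sub>q)\<close> for the residuals \<open>g\<close>, \<open>h\<close> of the two remaining
    equations, with the Jacobian at \<open>t = 0\<close>.  The residuals use the values updated in the first
    half; at \<open>t = 0\<close> they are therefore affine in \<open>(\<xi>\<^sub>p, \<xi>\<^sub>q)\<close> alone, and one Newton step lands
    exactly on \<open>\<zeta>\<close>.  This makes the iteration constant at \<open>t = 0\<close>.\<close>
  define g where "g s = coupling c (\<eta> s) (wnew s) a" for s
  define h where "h s = coupling c (\<eta> s) (vnew s) b" for s
  define \<xi>new where "\<xi>new s = (\<chi> i. \<eta> s $ i - (if i = p then (g s * c b q a - c a q b * h s) / D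
     else if i = q then (c a p b * h s - c b p a * g s) / D else 0))" for s
  define \<Phi> where "\<Phi> s = (\<xi>new s, vnew s, wnew s)" for s
  define x0 where "x0 = (\<zeta>, axis a 1 :: real ^ 'n, axis b 1 :: real ^ 'n)"
  define r where "r = Min (insert 1 ((\<lambda>i. \<bar>\<zeta> $ i\<bar>) ` (UNIV - {a, b}))) / 2"
  have "r > 0" using \<zeta>_nz by (simp add: r_def)
  \<comment> \<open>The radius keeps the denominators \<open>\<xi>\<^sub>i\<close> away from zero.\<close>
  have nz: "\<xi> $ i \<noteq> 0" if "(\<xi>, v, w) \<in> cball x0 r" "i \<noteq> a" "i \<noteq> b" for \<xi> v w i
  proof -
    have "\<bar>\<zeta> $ i - \<xi> $ i\<bar> \<le> norm (\<zeta> - \<xi>)"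
      using component_le_norm_cart[of "\<zeta> - \<xi>" i] by simp
    also have "\<dots> \<le> dist x0 (\<xi>, v, w)"
      using dist_fst_le[of x0 "(\<xi>, v, w)"] by (simp add: x0_def dist_norm)
    also have "\<dots> \<le> r" using that by simp
    also have "\<dots> \<le> \<bar>\<zeta> $ i\<bar> / 2"
      unfolding r_def using that by (intro divide_right_mono Min_le) auto
    finally show ?thesis using \<zeta>_nz[OF that(2,3)] by auto
  qed
  have cont: "continuous_on ({0..1} \<times> cball x0 r) \<Phi>"
  proof -
    let ?S = "{0..1::real} \<times> cball x0 r"
    have if_const: "continuous_on ?S (\<lambda>s. if P then f s else g s)"
      if "P \<Longrightarrow> continuous_on ?S f" "\<not> P \<Longrightarrow> continuous_on ?S g" for P and f g :: "_ \<Rightarrow> real"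
      using that by (cases P) simp_all
    have nz_snd: "fst (snd s) $ i \<noteq> 0" if "s \<in> ?S" "i \<noteq> a" "i \<noteq> b" for s i
      using that nz[of "fst (snd s)" "fst (snd (snd s))" "snd (snd (snd s))" i] by auto
    have v: "continuous_on ?S vnew" and w: "continuous_on ?S wnew"
      unfolding vnew_def wnew_def case_prod_unfold
      by (intro continuous_on_vec_lambda if_const continuous_intros ballI nz_snd; simp)+
    have \<eta>: "continuous_on ?S \<eta>"
      unfolding \<eta>_def case_prod_unfold
      by (intro continuous_on_vec_lambda if_const continuous_intros)
    have "continuous_on ?S \<xi>new"
      unfolding \<xi>new_def g_def h_def using \<open>D \<noteq> 0\<close>
      by (intro continuous_on_vec_lambda if_const continuous_intros v w \<eta> ballI)
    then show ?thesis unfolding \<Phi>_def by (intro continuous_intros v w)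
  qed
  have const: "\<Phi> (0, x) = x0" for x
  proof -
    obtain \<xi> v w where x: "x = (\<xi>, v, w)" by (cases x)
    let ?s = "(0::real, \<xi>, v, w)"
    have v0: "vnew ?s = axis a 1" and w0: "wnew ?s = axis b 1"
      using distinct by (auto simp: vnew_def wnew_def axis_def vec_eq_iff)
    \<comment> \<open>Each limit equation, evaluated at the updated point: \<open>\<zeta>\<close> solves it, and the updated point
      differs from \<open>\<zeta>\<close> only at \<open>p\<close> and \<open>q\<close>.\<close>
    have shift: "(\<Sum>k\<in>UNIV - {j}. f k * \<eta> ?s $ k) = f p * (\<xi> $ p - \<zeta> $ p) + f q * (\<xi> $ q - \<zeta> $ q)"
      if f: "(\<Sum>k\<in>UNIV - {a, b}. f k * \<zeta> $ k) = 0" and j: "j = a \<or> j = b" for f j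
    proof -
      have "(\<Sum>k\<in>UNIV - {j}. f k * \<eta> ?s $ k) = (\<Sum>k\<in>UNIV - {a, b}. f k * \<eta> ?s $ k)"
        using j by (intro sum.mono_neutral_right) (auto simp: \<eta>_def)
      also have "\<dots> = (\<Sum>k\<in>UNIV - {a, b}. f k * \<zeta> $ k) +
          (\<Sum>k\<in>UNIV - {a, b}. f k * (\<eta> ?s $ k - \<zeta> $ k))"
        by (simp add: algebra_simps flip: sum.distrib)
      also have "(\<Sum>k\<in>UNIV - {a, b}. f k * (\<eta> ?s $ k - \<zeta> $ k)) =
          (\<Sum>k\<in>{p, q}. f k * (\<xi> $ k - \<zeta> $ k))"
        using distinct by (intro sum.mono_neutral_cong_right) (auto simp: \<eta>_def)
      finally show ?thesis using f distinct by simp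
    qed
    have gh: "g ?s = c a p b * (\<xi> $ p - \<zeta> $ p) + c a q b * (\<xi> $ q - \<zeta> $ q)"
      "h ?s = c b p a * (\<xi> $ p - \<zeta> $ p) + c b q a * (\<xi> $ q - \<zeta> $ q)"
      unfolding g_def h_def v0 w0 coupling_axis using shift eq_ab eq_ba by auto
    have "(g ?s * c b q a - c a q b * h ?s) = D * (\<xi> $ p - \<zeta> $ p)"
      "(c a p b * h ?s - c b p a * g ?s) = D * (\<xi> $ q - \<zeta> $ q)"
      unfolding gh D_def by (simp_all add: algebra_simps)
    then have "\<xi>new ?s = \<zeta>"
      using distinct \<open>D \<noteq> 0\<close> \<zeta>_ab by (auto simp: \<xi>new_def vec_eq_iff \<eta>_def)
    then show ?thesis by (simp add: \<Phi>_def x x0_def v0 w0)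
  qed
  have "\<not> smooth_char_variety (scale_params t c)"
    if x: "x \<in> cball x0 r" "\<Phi> (t, x) = x" for t x
  proof -
    obtain \<xi> v w where x_eq: "x = (\<xi>, v, w)" by (cases x)
    let ?s = "(t, \<xi>, v, w)" and ?P = "principal_symbol \<xi> (scale_params t c)"
    have nz': "\<xi> $ i \<noteq> 0" if "i \<noteq> a" "i \<noteq> b" for i
      using nz[of \<xi> v w i] x(1) x_eq that by blast
    have fix_eqs: "\<xi>new ?s = \<xi>" "vnew ?s = v" "wnew ?s = w"
      using x(2) by (simp_all add: \<Phi>_def x_eq)
    \<comment> \<open>The two halves of the iteration change disjoint sets of coordinates, so a fixed point of their
      composition is fixed by each; for the Newton step this means that the residuals vanish.\<close>
    have "\<eta> ?s $ i = \<xi> $ i" for i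
    proof (cases "i = p \<or> i = q")
      case True
      then show ?thesis using distinct by (auto simp: \<eta>_def)
    next
      case False
      then show ?thesis using arg_cong[OF fix_eqs(1), of "\<lambda>z. z $ i"] by (simp add: \<xi>new_def)
    qed
    then have \<eta>_eq: "\<eta> ?s = \<xi>" by (simp add: vec_eq_iff)
    have "g ?s * c b q a - c a q b * h ?s = 0"
      using arg_cong[OF fix_eqs(1), of "\<lambda>z. z $ p"] \<open>D \<noteq> 0\<close> by (simp add: \<xi>new_def \<eta>_eq)
    moreover have "c a p b * h ?s - c b p a * g ?s = 0"
      using arg_cong[OF fix_eqs(1), of "\<lambda>z. z $ q"] \<open>D \<noteq> 0\<close> distinct
      by (auto simp: \<xi>new_def \<eta>_eq split: if_splits)
    ultimately have "D * g ?s = 0" "D * h ?s = 0"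
      unfolding D_def by algebra+
    then have res: "coupling c \<xi> w a = 0" "coupling c \<xi> v b = 0"
      using \<open>D \<noteq> 0\<close> by (simp_all add: g_def h_def \<eta>_eq fix_eqs)
    have v: "v $ i = (if i = a then 1 else if i = b then 0 else - t * coupling c \<xi> v i / \<xi> $ i)"
      for i by (subst fix_eqs(2)[symmetric]) (simp add: vnew_def)
    have w: "w $ i = (if i = a then 0 else if i = b then 1 else - t * coupling c \<xi> w i / \<xi> $ i)"
      for i by (subst fix_eqs(3)[symmetric]) (simp add: wnew_def)
    have \<xi>_ab: "\<xi> $ a = - t * coupling c \<xi> v a" "\<xi> $ b = - t * coupling c \<xi> w b"
      using arg_cong[OF \<eta>_eq, of "\<lambda>z. z $ a"] arg_cong[OF \<eta>_eq, of "\<lambda>z. z $ b"] distinct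
      by (auto simp: \<eta>_def)
    have "(?P *v v) $ i = 0" for i
      using \<xi>_ab res distinct v[of i] nz'[of i]
      by (auto simp: principal_symbol_scale_mult split: if_splits)
    moreover have "(?P *v w) $ i = 0" for i
      using \<xi>_ab res distinct w[of i] nz'[of i]
      by (auto simp: principal_symbol_scale_mult split: if_splits)
    ultimately have "rank ?P + 2 \<le> CARD('n)"
      using distinct v w by (intro rank_add_2_le[of _ v w a b]) (auto simp: vec_eq_iff)
    moreover have "\<xi> \<noteq> 0" using nz'[of p] distinct by auto
    ultimately show ?thesis
      by (auto simp: smooth_char_variety_def char_variety_sing_def)
  qed
  then show ?thesis
    using fixed_point_near_constant_map[OF \<open>r > 0\<close> cont const] by blast
qed

theorem theorem1p2:
  assumes "CARD('n::finite) \<ge> 5"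
  shows "\<exists>Qs :: ('n \<times> 'n \<times> 'n) real_mpoly set.
           finite Qs \<and>
           (\<forall>Q\<in>Qs. param_poly Q \<and> homogeneous_mpoly Q \<and> \<not> identically_zero Q) \<and>
           (\<forall>c :: 'n params. parameter_collection c \<longrightarrow>
              (\<forall>Q\<in>Qs. param_poly_eval Q c \<noteq> 0) \<longrightarrow>
              (\<exists>t0>0. \<forall>t. 0 < t \<longrightarrow> t < t0 \<longrightarrow>
                 \<not> smooth_char_variety (scale_params t c)))"
proof -
  obtain xs :: "'n list" where xs: "set xs = UNIV" "distinct xs"
    using finite_distinct_list[of "UNIV :: 'n set"] by auto
  then have "length xs \<ge> 5" using assms by (metis distinct_card)
  then obtain a b p q e ys where "xs = a # b # p # q # e # ys"
    by (auto simp: Suc_le_length_iff numeral_eq_Suc)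
  then have distinct: "distinct [a, b, p, q]" and e: "e \<notin> {a, b, p, q}"
    using xs by auto
  \<comment> \<open>The fifth index makes \<open>S\<close> nonempty; with \<open>S\<close> empty the limit equations would force \<open>\<zeta> = 0\<close>.\<close>
  define S where "S = UNIV - {a, b, p, q}"
  have "S \<noteq> {}" using e by (auto simp: S_def)
  obtain Q1 Q2 Q3 where
    Q1: "param_poly Q1 \<and> homogeneous_mpoly Q1 \<and> \<not> identically_zero Q1"
      "\<And>c. param_poly_eval Q1 c = block_minor c a b {p} {q}" and
    Q2: "param_poly Q2 \<and> homogeneous_mpoly Q2 \<and> \<not> identically_zero Q2"
      "\<And>c. param_poly_eval Q2 c = block_minor c a b S {q}" and
    Q3: "param_poly Q3 \<and> homogeneous_mpoly Q3 \<and> \<not> identically_zero Q3"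
      "\<And>c. param_poly_eval Q3 c = block_minor c a b {p} S"
    using block_minor_param_poly[of a b "{p}" "{q}"] block_minor_param_poly[of a b S "{q}"]
      block_minor_param_poly[of a b "{p}" S] distinct \<open>S \<noteq> {}\<close>
    by (auto simp: S_def)
  have "\<exists>t0>0. \<forall>t. 0 < t \<longrightarrow> t < t0 \<longrightarrow> \<not> smooth_char_variety (scale_params t c)"
    if nz: "\<forall>Q\<in>{Q1, Q2, Q3}. param_poly_eval Q c \<noteq> 0" for c :: "'n params"
  proof -
    have minors: "block_minor c a b {p} {q} \<noteq> 0" "block_minor c a b S {q} \<noteq> 0"
      "block_minor c a b {p} S \<noteq> 0"
      using nz Q1 Q2 Q3 by auto
    \<comment> \<open>Cramer's rule for the coordinates \<open>p\<close>, \<open>q\<close>, cleared of the denominator.\<close>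
    define \<zeta> :: "real ^ 'n" where "\<zeta> = (\<chi> i. if i = a \<or> i = b then 0
      else if i = p then - block_minor c a b S {q} else if i = q then - block_minor c a b {p} S
      else block_minor c a b {p} {q})"
    have split: "(\<Sum>k\<in>UNIV - {a, b}. f k * \<zeta> $ k) = - f p * block_minor c a b S {q}
        - f q * block_minor c a b {p} S + (\<Sum>k\<in>S. f k) * block_minor c a b {p} {q}" for f
    proof -
      have "UNIV - {a, b} = insert p (insert q S)" "p \<notin> S" "q \<notin> S"
        using distinct by (auto simp: S_def)
      moreover have "(\<Sum>k\<in>S. f k * \<zeta> $ k) = (\<Sum>k\<in>S. f k * block_minor c a b {p} {q})"
        by (intro sum.cong) (auto simp: \<zeta>_def S_def)
      ultimately show ?thesis using distinct by (auto simp: \<zeta>_def sum_distrib_right)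
    qed
    show ?thesis
    proof (rule not_smooth_near_double_axis[OF distinct minors(1), of \<zeta>])
      show "(\<Sum>k\<in>UNIV - {a, b}. c a k b * \<zeta> $ k) = 0"
        "(\<Sum>k\<in>UNIV - {a, b}. c b k a * \<zeta> $ k) = 0"
        unfolding split by (simp_all add: block_minor_def algebra_simps)
    qed (use minors in \<open>auto simp: \<zeta>_def\<close>)
  qed
  then show ?thesis
    using Q1(1) Q2(1) Q3(1) by (intro exI[of _ "{Q1, Q2, Q3}"]) auto
qed

end
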